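(* Let $(\mathfrak h,[\,,\,]_{\mathfrak h})$ be a real Lie algebra with an ad-invariant metric $h$ and let $D\colon\mathfrak h\to\mathfrak h$ be a skew-symmetric derivation of rank two. Then the vector space $\mathfrak g=\mathfrak h\oplus\operatorname{Span}\{U\}$ has a Lie algebra structure, defined by a Lie bracket $[\,,\,]$, and an ad-invariant metric $g$, given by $$[X,Y]=[X,Y]_{\mathfrak h}+h(DX,Y)U,\qquad [U,X]=DX,$$ $$g(X,Y)=h(X,Y),\qquad g(X,U)=0,\qquad g(U,U)=1,$$ where $X,Y\in\mathfrak h$. Moreover, if $D$ is noninner and satisfies $\mathfrak z(\mathfrak h)\subset\ker D$, then $$\mathfrak g'=\mathfrak h'\oplus\operatorname{Span}\{U\},\qquad \mathfrak z(\mathfrak g)=\mathfrak z(\mathfrak h).$$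
   Context: Lie algebras are real and finite-dimensional. An ad-invariant metric on a Lie algebra is a nondegenerate symmetric bilinear form $g$ (any signature) with $g([X,Y],Z)=-g(Y,[X,Z])$ for all $X,Y,Z$. Skew-symmetric means $h(DX,Y)=-h(X,DY)$. For a Lie algebra $\mathfrak a$, $\mathfrak a'=[\mathfrak a,\mathfrak a]$ and $\mathfrak z(\mathfrak a)$ is the center. *)

theory Defs
  imports "HOL-Analysis.Analysis"
begin

(* A Lie algebra structure lives on the whole type, which need not carry a norm or
   an inner product. *)
definition lie_algebra :: "('a::real_vector \<Rightarrow> 'a \<Rightarrow> 'a) \<Rightarrow> bool" where
  "lie_algebra br \<longleftrightarrow>
     (\<exists>B::'a set. finite B \<and> span B = UNIV) \<and>
     bilinear br \<and>
     (\<forall>x. br x x = 0) \<and>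
     (\<forall>x y z. br (br x y) z + br (br y z) x + br (br z x) y = 0)"

definition ad_invariant_metric ::
    "('a::real_vector \<Rightarrow> 'a \<Rightarrow> 'a) \<Rightarrow> ('a \<Rightarrow> 'a \<Rightarrow> real) \<Rightarrow> bool" where
  "ad_invariant_metric br g \<longleftrightarrow>
     bilinear g \<and>
     (\<forall>x y. g x y = g y x) \<and>
     (\<forall>x. (\<forall>y. g x y = 0) \<longrightarrow> x = 0) \<and>
     (\<forall>x y z. g (br x y) z = - g y (br x z))"

definition skew_symmetric :: "('a \<Rightarrow> 'a \<Rightarrow> real) \<Rightarrow> ('a \<Rightarrow> 'a) \<Rightarrow> bool" where
  "skew_symmetric h D \<longleftrightarrow> (\<forall>x y. h (D x) y = - h x (D y))"

definition derivation :: "('a::real_vector \<Rightarrow> 'a \<Rightarrow> 'a) \<Rightarrow> ('a \<Rightarrow> 'a) \<Rightarrow> bool" where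
  "derivation br D \<longleftrightarrow> linear D \<and> (\<forall>x y. D (br x y) = br (D x) y + br x (D y))"

definition inner_derivation :: "('a \<Rightarrow> 'a \<Rightarrow> 'a) \<Rightarrow> ('a \<Rightarrow> 'a) \<Rightarrow> bool" where
  "inner_derivation br D \<longleftrightarrow> (\<exists>x. \<forall>y. D y = br x y)"

definition derived_algebra :: "('a::real_vector \<Rightarrow> 'a \<Rightarrow> 'a) \<Rightarrow> 'a set" where
  "derived_algebra br = span {br x y | x y. True}"

definition center :: "('a::zero \<Rightarrow> 'a \<Rightarrow> 'a) \<Rightarrow> 'a set" where
  "center br = {x. \<forall>y. br x y = 0}"

definition is_direct_sum :: "'a::real_vector set \<Rightarrow> 'a set \<Rightarrow> 'a set \<Rightarrow> bool" where
  "is_direct_sum W A B \<longleftrightarrow> W = {a + b | a b. a \<in> A \<and> b \<in> B} \<and> A \<inter> B = {0}"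

(* The vector space h + Span{U} is modelled by pairs: (X, a) stands for X + a U. *)
definition incl :: "'a::real_vector \<Rightarrow> 'a \<times> real" where
  "incl X = (X, 0)"

definition U :: "'a::real_vector \<times> real" where
  "U = (0, 1)"

(* Bilinear, alternating extension of
   [X,Y] = [X,Y]_h + h(DX,Y) U and [U,X] = DX, so that [U,U] = 0 and [X,U] = - DX. *)
definition ext_bracket ::
    "('a::real_vector \<Rightarrow> 'a \<Rightarrow> 'a) \<Rightarrow> ('a \<Rightarrow> 'a \<Rightarrow> real) \<Rightarrow> ('a \<Rightarrow> 'a) \<Rightarrow>
     'a \<times> real \<Rightarrow> 'a \<times> real \<Rightarrow> 'a \<times> real" where
  "ext_bracket br h D v w =
     incl (br (fst v) (fst w)) + h (D (fst v)) (fst w) *\<^sub>R U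
     + snd v *\<^sub>R incl (D (fst w)) - snd w *\<^sub>R incl (D (fst v))"

definition ext_metric ::
    "('a \<Rightarrow> 'a \<Rightarrow> real) \<Rightarrow> 'a \<times> real \<Rightarrow> 'a \<times> real \<Rightarrow> real" where
  "ext_metric h v w = h (fst v) (fst w) + snd v * snd w"

end

theory Submission
  imports Defs
begin

text \<open>
  Let \<open>\<hh>\<close> be the given Lie algebra and \<open>\<omega> X Y = h (D X) Y\<close>; skewness of \<open>D\<close> makes this bilinear form alternating. The Jacobi
  identity for the extended bracket, applied to \<open>X\<close>, \<open>Y\<close>, \<open>Z\<close> in \<open>\<hh>\<close>, has two parts.
  The \<open>U\<close>-component is the cyclic sum of \<open>h (D [X,Y]) Z\<close>; because \<open>D\<close> is a skew derivation, it
  annihilates the three-form \<open>h [X,Y] Z\<close>, and the sum is zero. What remains in \<open>\<hh>\<close> is the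
  cyclic sum of \<open>\<omega> X Y \<cdot> D Z\<close>, and this is where the rank of \<open>D\<close> enters: in
  coordinates on the plane \<open>range D\<close>, \<open>\<omega>\<close> is a multiple of a two-by-two minor, and the cyclic
  sum is the expansion of a determinant with a repeated row
  (\<open>skew_rank_two_cyclic_sum\<close>). The triples involving \<open>U\<close> only express that \<open>D\<close> is a derivation
  and that \<open>h (D (D X)) Y\<close> is symmetric.

  For the second half, an ad-invariant metric makes the derived algebra the orthogonal
  complement of the center (\<open>derived_algebra_iff_orthogonal_center\<close>). So it suffices to find the
  center of the extension. If \<open>X + a U\<close> is central with \<open>a \<noteq> 0\<close>, then \<open>D\<close> is the inner
  derivation of \<open>-X/a\<close>; thus \<open>a = 0\<close>, and the center is that of \<open>\<hh>\<close>, as the latter is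
  killed by \<open>D\<close>. Its orthogonal complement in the extension is its complement in \<open>\<hh>\<close>,
  namely the derived algebra of \<open>\<hh>\<close>, together with the line of \<open>U\<close>.
\<close>

section \<open>Orthogonality for nondegenerate forms in finite dimension\<close>

text \<open>
  The map sending \<open>y\<close> to the vector with coordinates \<open>g y b\<close> in a basis is injective by
  nondegeneracy, hence surjective; so every functional can be matched on the basis.
\<close>

lemma nondegenerate_form_represents_functional:
  fixes g :: "'a::real_vector \<Rightarrow> 'a \<Rightarrow> real" and f :: "'a \<Rightarrow> real"
  assumes fin: "\<exists>B::'a set. finite B \<and> span B = UNIV"
    and g: "bilinear g"
    and nondeg: "\<And>y. (\<And>x. g y x = 0) \<Longrightarrow> y = 0"
    and f: "linear f"
  shows "\<exists>y. \<forall>x. g y x = f x"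
proof -
  obtain B0 :: "'a set" where B0: "finite B0" "span B0 = UNIV" using fin by blast
  obtain B where B: "B \<subseteq> B0" "independent B" "B0 \<subseteq> span B"
    using maximal_independent_subset by blast
  have finB: "finite B" using B(1) B0(1) by (rule finite_subset)
  have spanB: "span B = UNIV"
    using B(3) B0(2) by (metis span_mono span_span top.extremum_uniqueI)
  interpret fd: finite_dimensional_vector_space "scaleR :: real \<Rightarrow> 'a \<Rightarrow> 'a" B
    using finB B(2) spanB
    by unfold_locales
      (auto simp: span_raw_def dependent_raw_def scaleR_right_distrib scaleR_left_distrib)
  define \<phi> where "\<phi> y = (\<Sum>b\<in>B. g y b *\<^sub>R b)" for y
  have lin: "linear \<phi>"
    unfolding \<phi>_def
    by (rule linearI)
      (simp_all add: bilinear_ladd[OF g] bilinear_lmul[OF g] scaleR_left_distrib sum.distrib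
        scaleR_sum_right)
  have coords: "c b = d b" if "(\<Sum>b\<in>B. c b *\<^sub>R b) = (\<Sum>b\<in>B. d b *\<^sub>R b)" "b \<in> B"
    for c d :: "'a \<Rightarrow> real" and b
  proof -
    have "(\<Sum>b\<in>B. (c b - d b) *\<^sub>R b) = 0"
      using that(1) by (simp add: scaleR_left_diff_distrib sum_subtractf)
    then show ?thesis
      using independentD[OF B(2) finB subset_refl, of "\<lambda>b. c b - d b"] that(2) by simp
  qed
  have agree: "g y x = k x" if "linear k" "\<And>b. b \<in> B \<Longrightarrow> g y b = k b" for k x y
  proof -
    have "linear (g y)" using g by (simp add: bilinear_def)
    then show ?thesis using linear_eq_on_span that spanB by blast
  qed
  have "inj \<phi>"
  proof (rule linear_injective_0[OF lin, THEN iffD2], intro allI impI)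
    fix y assume "\<phi> y = 0"
    then have "\<And>b. b \<in> B \<Longrightarrow> g y b = 0"
      using coords[of "g y" "\<lambda>_. 0"] by (simp add: \<phi>_def)
    then have "g y x = 0" for x
      using agree[of "\<lambda>_. 0" y x] by (simp add: linear_zero)
    then show "y = 0" by (rule nondeg)
  qed
  then have "surj \<phi>"
    using lin fd.linear_inj_imp_surj unfolding linear_def by blast
  then obtain y where "\<phi> y = (\<Sum>b\<in>B. f b *\<^sub>R b)" by (metis surjD)
  then have "\<And>b. b \<in> B \<Longrightarrow> g y b = f b"
    using coords[of "g y" f] by (simp add: \<phi>_def)
  then show ?thesis using agree[OF f] by blast
qed

lemma nondegenerate_form_separates_span:
  fixes g :: "'a::real_vector \<Rightarrow> 'a \<Rightarrow> real"
  assumes fin: "\<exists>B::'a set. finite B \<and> span B = UNIV"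
    and g: "bilinear g"
    and nondeg: "\<And>y. (\<And>x. g y x = 0) \<Longrightarrow> y = 0"
    and x: "x \<notin> span S"
  shows "\<exists>y. (\<forall>s\<in>S. g y s = 0) \<and> g y x \<noteq> 0"
proof -
  obtain C where C: "C \<subseteq> S" "independent C" "S \<subseteq> span C"
    using maximal_independent_subset by blast
  have xC: "x \<notin> span C" using x C(1) span_mono by blast
  then have ind: "independent (insert x C)" using C(2) by (rule independent_insertI)
  obtain f :: "'a \<Rightarrow> real" where f: "linear f"
      "\<forall>z\<in>insert x C. f z = (if z = x then 1 else 0)"
    using linear_independent_extend[OF ind, of "\<lambda>z. if z = x then 1 else 0"] by blast
  have fC: "f c = 0" if "c \<in> C" for c
    using f(2) that xC span_base by fastforce
  have "f s = 0" if "s \<in> S" for s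
    using linear_eq_0_on_span[OF f(1) fC] C(3) that by blast
  moreover obtain y where "\<forall>z. g y z = f z"
    using nondegenerate_form_represents_functional[OF fin g nondeg f(1)] by blast
  ultimately show ?thesis using f(2) by (intro exI[of _ y]) simp
qed

section \<open>The derived algebra of a metric Lie algebra\<close>

lemma lie_algebra_antisym:
  assumes "lie_algebra br"
  shows "br x y = - br y x"
proof -
  have b: "bilinear br" and alt: "\<And>x. br x x = 0" using assms by (auto simp: lie_algebra_def)
  have "br (x + y) (x + y) = br x x + br x y + (br y x + br y y)"
    by (simp only: bilinear_ladd[OF b] bilinear_radd[OF b] ac_simps)
  then have "br x y + br y x = 0" by (simp add: alt)
  then show ?thesis by (simp add: eq_neg_iff_add_eq_0)
qed

text \<open>
  Ad-invariance moves a bracket across the metric, so a vector is orthogonal to all brackets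
  exactly if its brackets are orthogonal to everything, that is, if it is central. That the derived
  algebra equals its own double complement is where finite dimension is essential.
\<close>

lemma derived_algebra_iff_orthogonal_center:
  fixes br :: "'a::real_vector \<Rightarrow> 'a \<Rightarrow> 'a"
  assumes L: "lie_algebra br" and M: "ad_invariant_metric br g"
  shows "x \<in> derived_algebra br \<longleftrightarrow> (\<forall>c\<in>center br. g c x = 0)"
proof
  have g: "bilinear g" and sym: "\<And>x y. g x y = g y x"
    and nondeg: "\<And>x. (\<And>y. g x y = 0) \<Longrightarrow> x = 0"
    and inv: "\<And>x y z. g (br x y) z = - g y (br x z)"
    using M unfolding ad_invariant_metric_def by blast+
  note anti = lie_algebra_antisym[OF L]
  show "\<forall>c\<in>center br. g c x = 0" if x: "x \<in> derived_algebra br"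
  proof
    fix c assume c: "c \<in> center br"
    have "linear (g c)" using g by (simp add: bilinear_def)
    moreover have "g c s = 0" if s_in: "s \<in> {br x y | x y. True}" for s
    proof -
      obtain u v where s: "s = br u v" using s_in by blast
      have "br u c = 0" using anti[of u c] c by (simp add: center_def)
      then show ?thesis
        using inv[of u v c] sym[of c s] by (simp add: s bilinear_rzero[OF g])
    qed
    ultimately show "g c x = 0"
      using linear_eq_0_on_span x unfolding derived_algebra_def by blast
  qed
  show "x \<in> derived_algebra br" if orth: "\<forall>c\<in>center br. g c x = 0"
  proof (rule ccontr)
    assume "x \<notin> derived_algebra br"
    then obtain y where y: "\<forall>s\<in>{br x y | x y. True}. g y s = 0" "g y x \<noteq> 0"
      using nondegenerate_form_separates_span[OF _ g nondeg] L
      unfolding derived_algebra_def lie_algebra_def by meson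
    have "br y u = 0" for u
    proof -
      have "g (br u y) v = 0" for v using inv[of u y v] y(1) by auto
      then have "br u y = 0" by (rule nondeg)
      then show ?thesis using anti[of y u] by simp
    qed
    then show False using orth y(2) by (simp add: center_def)
  qed
qed

section \<open>Skew-symmetric endomorphisms of rank two\<close>

text \<open>
  For a basis \<open>e = D E\<close>, \<open>f = D F\<close> of the image and \<open>D X = a X e + b X f\<close>, skewness gives
  \<open>h e Y = - h E (D Y)\<close>, in which only the \<open>f\<close>-coordinate of \<open>D Y\<close> survives because
  \<open>h E (D E) = 0\<close>. Hence \<open>h (D X) Y\<close> is a constant multiple of the minor \<open>b X a Y - a X b Y\<close>.
\<close>

lemma skew_rank_two_cyclic_sum:
  fixes h :: "'a::real_vector \<Rightarrow> 'a \<Rightarrow> real"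
  assumes h: "bilinear h" and sym: "\<And>x y. h x y = h y x"
    and skew: "skew_symmetric h D" and dim: "dim (range D) = 2"
  shows "h (D x) y *\<^sub>R D z + h (D y) z *\<^sub>R D x + h (D z) x *\<^sub>R D y = 0"
proof -
  have sk: "h (D u) v = - h u (D v)" for u v using skew by (simp add: skew_symmetric_def)
  obtain B where B: "B \<subseteq> range D" "range D \<subseteq> span B" "card B = 2"
    using basis_exists[of "range D"] dim by metis
  obtain e f where ef: "B = {e, f}" using B(3) by (auto simp: card_2_iff)
  obtain E F where E: "e = D E" and F: "f = D F" using B(1) ef by blast
  have "\<exists>p q. D u = p *\<^sub>R e + q *\<^sub>R f" for u
  proof -
    have "D u \<in> span {e, f}" using B(2) ef by blast
    then obtain p where "D u - p *\<^sub>R e \<in> span {f}" by (auto simp: span_insert)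
    then obtain q where "D u - p *\<^sub>R e = q *\<^sub>R f" by (auto simp: span_singleton)
    then show ?thesis by (metis add.commute diff_add_cancel)
  qed
  then obtain a b where ab: "\<And>u. D u = a u *\<^sub>R e + b u *\<^sub>R f" by metis
  have he: "h E e = 0" and hf: "h F f = 0"
    using sk[of E E] sk[of F F] sym[of E e] sym[of F f] E F by auto
  have hef: "h F e = - h E f"
    using sk[of E F] sym[of F e] E F by simp
  have minor: "h (D u) v = h E f * (b u * a v - a u * b v)" for u v
  proof -
    have "h e v = - h E (D v)" "h f v = - h F (D v)" using sk E F by auto
    then have "h e v = - b v * h E f" "h f v = a v * h E f"
      by (simp_all add: ab[of v] bilinear_radd[OF h] bilinear_rmul[OF h] he hf hef)
    then show ?thesis
      by (simp add: ab[of u] bilinear_ladd[OF h] bilinear_lmul[OF h] algebra_simps)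
  qed
  show ?thesis
    unfolding minor
    by (simp add: ab[of x] ab[of y] ab[of z] algebra_simps)
qed

section \<open>The extension by a skew-symmetric derivation\<close>

lemma ext_bracket_eq:
  "ext_bracket br h D v w =
     (br (fst v) (fst w) + snd v *\<^sub>R D (fst w) - snd w *\<^sub>R D (fst v), h (D (fst v)) (fst w))"
  by (simp add: ext_bracket_def incl_def U_def prod_eq_iff)

lemma finite_spanning_prod_real:
  assumes "\<exists>B::'a::real_vector set. finite B \<and> span B = UNIV"
  shows "\<exists>B::('a \<times> real) set. finite B \<and> span B = UNIV"
proof -
  obtain B :: "'a set" where B: "finite B" "span B = UNIV" using assms by blast
  have lin: "linear (incl :: 'a \<Rightarrow> 'a \<times> real)" by (rule linearI) (simp_all add: incl_def)
  have "v \<in> span (insert U (incl ` B))" for v :: "'a \<times> real"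
  proof -
    have "incl (fst v) \<in> span (incl ` B)"
      using linear_span_image[OF lin, of B] B(2) by auto
    then have "incl (fst v) \<in> span (insert U (incl ` B))"
      using span_mono[of "incl ` B" "insert U (incl ` B)"] by blast
    moreover have "snd v *\<^sub>R U \<in> span (insert U (incl ` B))"
      by (intro span_scale span_base) simp
    moreover have "v = incl (fst v) + snd v *\<^sub>R U"
      by (simp add: incl_def U_def prod_eq_iff)
    ultimately show ?thesis by (metis span_add)
  qed
  then have "span (insert U (incl ` B)) = UNIV" by blast
  then show ?thesis using B(1) by (metis finite.insertI finite_imageI)
qed

lemma lie_algebra_ext_bracket:
  fixes br :: "'h::real_vector \<Rightarrow> 'h \<Rightarrow> 'h"
  assumes L: "lie_algebra br" and M: "ad_invariant_metric br h"
    and der: "derivation br D" and skew: "skew_symmetric h D"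
    and dim: "dim (range D) = 2"
  shows "lie_algebra (ext_bracket br h D)"
proof -
  have b: "bilinear br" and alt: "\<And>x. br x x = 0"
    and jac: "\<And>x y z. br (br x y) z + br (br y z) x + br (br z x) y = 0"
    using L unfolding lie_algebra_def by blast+
  have h: "bilinear h" and sym: "\<And>x y. h x y = h y x"
    and inv: "\<And>x y z. h (br x y) z = - h y (br x z)"
    using M unfolding ad_invariant_metric_def by blast+
  have D: "linear D" and leib: "\<And>x y. D (br x y) = br (D x) y + br x (D y)"
    using der unfolding derivation_def by blast+
  have sk: "\<And>x y. h (D x) y = - h x (D y)" using skew by (simp add: skew_symmetric_def)
  note anti = lie_algebra_antisym[OF L]
  note lin = bilinear_ladd[OF b] bilinear_radd[OF b] bilinear_lmul[OF b] bilinear_rmul[OF b]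
    bilinear_lsub[OF b] bilinear_rsub[OF b]
    bilinear_ladd[OF h] bilinear_radd[OF h] bilinear_lmul[OF h] bilinear_rmul[OF h]
    bilinear_lsub[OF h] bilinear_rsub[OF h]
    linear_add[OF D] linear_scale[OF D] linear_diff[OF D]
  have omega_alt: "h (D x) x = 0" for x using sk[of x x] sym[of x "D x"] by simp
  have D2: "h (D (D x)) y = h (D (D y)) x" for x y
    using sk[of "D x" y] sk[of "D y" x] sym[of "D x" "D y"] by simp
  have threeform: "h (br x y) z = h (br y z) x" for x y z
    using inv[of y x z] anti[of x y] sym[of x "br y z"]
    by (simp add: bilinear_lneg[OF h])
  \<comment> \<open>Let \<open>T\<close> be the cyclic sum of \<open>h (br x y) (D z)\<close>. By skewness the sum below is \<open>-T\<close>, and by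
    the Leibniz rule and the cyclic invariance of the three-form it is \<open>2 T\<close>.\<close>
  have D_threeform: "h (D (br x y)) z + h (D (br y z)) x + h (D (br z x)) y = 0" for x y z
  proof -
    have 1: "h (D (br u v)) w = - h (br u v) (D w)" for u v w by (rule sk)
    have 2: "h (D (br u v)) w = h (br v w) (D u) + h (br w u) (D v)" for u v w
      using threeform[of "D u" v w] threeform[of w u "D v"]
      by (simp add: leib bilinear_ladd[OF h])
    show ?thesis
      using 1[of x y z] 1[of y z x] 1[of z x y] 2[of x y z] by simp
  qed
  have bil: "bilinear (ext_bracket br h D)"
    unfolding bilinear_def
    by (intro conjI allI; rule linearI) (simp_all add: ext_bracket_eq lin algebra_simps)
  have "ext_bracket br h D v v = 0" for v
    by (simp add: ext_bracket_eq alt omega_alt zero_prod_def)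
  moreover have "ext_bracket br h D (ext_bracket br h D u v) w
      + ext_bracket br h D (ext_bracket br h D v w) u
      + ext_bracket br h D (ext_bracket br h D w u) v = 0" for u v w
  proof -
    obtain x p y q z r where u: "u = (x, p)" and v: "v = (y, q)" and w: "w = (z, r)"
      by (metis surj_pair)
    note cyc = skew_rank_two_cyclic_sum[OF h sym skew dim, of x y z]
    have fst0: "(br (br x y + p *\<^sub>R D y - q *\<^sub>R D x) z + h (D x) y *\<^sub>R D z
          - r *\<^sub>R D (br x y + p *\<^sub>R D y - q *\<^sub>R D x))
        + (br (br y z + q *\<^sub>R D z - r *\<^sub>R D y) x + h (D y) z *\<^sub>R D x
          - p *\<^sub>R D (br y z + q *\<^sub>R D z - r *\<^sub>R D y))
        + (br (br z x + r *\<^sub>R D x - p *\<^sub>R D z) y + h (D z) x *\<^sub>R D y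
          - q *\<^sub>R D (br z x + r *\<^sub>R D x - p *\<^sub>R D z)) = 0" (is "?l = 0")
    proof -
      have "?l = (br (br x y) z + br (br y z) x + br (br z x) y)
        + (h (D x) y *\<^sub>R D z + h (D y) z *\<^sub>R D x + h (D z) x *\<^sub>R D y)"
        by (simp add: lin leib anti[of x "D y"] anti[of y "D z"] anti[of z "D x"] algebra_simps)
      then show ?thesis using jac cyc by simp
    qed
    have snd0: "h (D (br x y + p *\<^sub>R D y - q *\<^sub>R D x)) z
        + h (D (br y z + q *\<^sub>R D z - r *\<^sub>R D y)) x
        + h (D (br z x + r *\<^sub>R D x - p *\<^sub>R D z)) y = 0" (is "?l = 0")
    proof -
      have "?l = h (D (br x y)) z + h (D (br y z)) x + h (D (br z x)) y"
        using D2[of x y] D2[of y z] D2[of z x] by (simp add: lin algebra_simps)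
      then show ?thesis using D_threeform by simp
    qed
    show ?thesis using fst0 snd0 by (simp add: ext_bracket_eq u v w zero_prod_def)
  qed
  ultimately show ?thesis
    using bil finite_spanning_prod_real L unfolding lie_algebra_def by blast
qed

lemma ad_invariant_ext_metric:
  fixes br :: "'h::real_vector \<Rightarrow> 'h \<Rightarrow> 'h"
  assumes M: "ad_invariant_metric br h" and skew: "skew_symmetric h D"
  shows "ad_invariant_metric (ext_bracket br h D) (ext_metric h)"
proof -
  have h: "bilinear h" and sym: "\<And>x y. h x y = h y x"
    and nondeg: "\<And>x. (\<And>y. h x y = 0) \<Longrightarrow> x = 0"
    and inv: "\<And>x y z. h (br x y) z = - h y (br x z)"
    using M unfolding ad_invariant_metric_def by blast+
  have sk: "\<And>x y. h (D x) y = - h x (D y)" using skew by (simp add: skew_symmetric_def)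
  note lin = bilinear_ladd[OF h] bilinear_radd[OF h] bilinear_lmul[OF h] bilinear_rmul[OF h]
    bilinear_lsub[OF h] bilinear_rsub[OF h]
  have bil: "bilinear (ext_metric h)"
    unfolding bilinear_def
    by (intro conjI allI; rule linearI) (simp_all add: ext_metric_def lin algebra_simps)
  have symm: "ext_metric h v w = ext_metric h w v" for v w
    using sym by (simp add: ext_metric_def mult.commute)
  have nd: "v = 0" if v: "\<forall>w. ext_metric h v w = 0" for v
  proof -
    have "h (fst v) y = 0" for y using v[rule_format, of "(y, 0)"] by (simp add: ext_metric_def)
    then have "fst v = 0" by (rule nondeg)
    moreover have "snd v = 0"
      using v[rule_format, of "(0, 1)"] by (simp add: ext_metric_def bilinear_rzero[OF h])
    ultimately show ?thesis by (simp add: prod_eq_iff)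
  qed
  have "ext_metric h (ext_bracket br h D u v) w = - ext_metric h v (ext_bracket br h D u w)"
    for u v w
    using inv[of "fst u" "fst v" "fst w"] sk[of "fst v" "fst w"]
      sym[of "fst v" "D (fst u)"]
    by (simp add: ext_metric_def ext_bracket_eq lin algebra_simps)
  then show ?thesis
    using bil symm nd unfolding ad_invariant_metric_def by blast
qed

lemma center_ext_bracket:
  fixes br :: "'h::real_vector \<Rightarrow> 'h \<Rightarrow> 'h"
  assumes L: "lie_algebra br" and M: "ad_invariant_metric br h"
    and outer: "\<not> inner_derivation br D" and ker: "center br \<subseteq> {X. D X = 0}"
  shows "center (ext_bracket br h D) = incl ` center br"
proof
  have b: "bilinear br" using L unfolding lie_algebra_def by blast
  have h: "bilinear h" using M unfolding ad_invariant_metric_def by blast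
  show "incl ` center br \<subseteq> center (ext_bracket br h D)"
  proof
    fix v assume "v \<in> incl ` center br"
    then obtain x where v: "v = incl x" and x: "\<And>y. br x y = 0" "D x = 0"
      using ker by (auto simp: center_def)
    show "v \<in> center (ext_bracket br h D)"
      by (simp add: center_def ext_bracket_eq v incl_def x bilinear_lzero[OF h] zero_prod_def)
  qed
  show "center (ext_bracket br h D) \<subseteq> incl ` center br"
  proof
    fix v assume "v \<in> center (ext_bracket br h D)"
    then have "ext_bracket br h D v (y, 0) = 0" for y by (simp add: center_def)
    then have br: "br (fst v) y + snd v *\<^sub>R D y = 0" for y
      by (simp add: ext_bracket_eq zero_prod_def)
    have "snd v = 0"
    proof (rule ccontr)
      assume a: "snd v \<noteq> 0"
      have "D y = br ((- 1 / snd v) *\<^sub>R fst v) y" for y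
      proof -
        have "br (fst v) y = - snd v *\<^sub>R D y" using br[of y] by (simp add: add_eq_0_iff2)
        then show ?thesis using a by (simp only: bilinear_lmul[OF b]) simp
      qed
      then show False using outer unfolding inner_derivation_def by blast
    qed
    moreover from this have "fst v \<in> center br" using br by (simp add: center_def)
    ultimately show "v \<in> incl ` center br"
      by (auto simp: incl_def prod_eq_iff image_iff)
  qed
qed

text \<open>
  The center of the extension lies in the first factor, which is orthogonal to \<open>U\<close>; hence its
  orthogonal complement restricts only the first component of a pair and contains the line of \<open>U\<close>.
\<close>

lemma derived_algebra_ext_bracket:
  fixes br :: "'h::real_vector \<Rightarrow> 'h \<Rightarrow> 'h"
  assumes L: "lie_algebra br" and M: "ad_invariant_metric br h"
    and Lext: "lie_algebra (ext_bracket br h D)" and skew: "skew_symmetric h D"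
    and cent: "center (ext_bracket br h D) = incl ` center br"
  shows "is_direct_sum (derived_algebra (ext_bracket br h D))
    (incl ` derived_algebra br) (span {U})"
proof -
  have "v \<in> derived_algebra (ext_bracket br h D) \<longleftrightarrow> fst v \<in> derived_algebra br" for v
    using derived_algebra_iff_orthogonal_center[OF Lext ad_invariant_ext_metric[OF M skew]]
      derived_algebra_iff_orthogonal_center[OF L M]
    by (simp add: cent ext_metric_def incl_def)
  moreover have "fst v \<in> derived_algebra br \<longleftrightarrow>
      (\<exists>a b. v = a + b \<and> a \<in> incl ` derived_algebra br \<and> b \<in> span {U})" for v
  proof
    assume "fst v \<in> derived_algebra br"
    moreover have "v = incl (fst v) + snd v *\<^sub>R U" by (simp add: incl_def U_def prod_eq_iff)
    ultimately show "\<exists>a b. v = a + b \<and> a \<in> incl ` derived_algebra br \<and> b \<in> span {U}"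
      by (metis imageI span_base span_scale singletonI)
  qed (auto simp: span_singleton incl_def U_def)
  ultimately have "derived_algebra (ext_bracket br h D)
      = {a + b | a b. a \<in> incl ` derived_algebra br \<and> b \<in> span {U}}" by blast
  moreover have "incl ` derived_algebra br \<inter> span {U} = {0}"
  proof -
    have "0 \<in> derived_algebra br" by (simp add: derived_algebra_def span_zero)
    then have "(0 :: 'h \<times> real) \<in> incl ` derived_algebra br"
      by (auto simp: incl_def zero_prod_def)
    then show ?thesis
      by (auto simp: span_zero span_singleton incl_def U_def zero_prod_def)
  qed
  ultimately show ?thesis by (simp add: is_direct_sum_def)
qed

theorem proposition2p1:
  fixes br :: "'h::real_vector \<Rightarrow> 'h \<Rightarrow> 'h"
    and h :: "'h \<Rightarrow> 'h \<Rightarrow> real"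
    and D :: "'h \<Rightarrow> 'h"
  assumes "lie_algebra br"
    and "ad_invariant_metric br h"
    and "derivation br D"
    and "skew_symmetric h D"
    and "dim (range D) = 2"
  shows "lie_algebra (ext_bracket br h D)
    \<and> ad_invariant_metric (ext_bracket br h D) (ext_metric h)
    \<and> (\<forall>X Y. ext_bracket br h D (incl X) (incl Y) = incl (br X Y) + h (D X) Y *\<^sub>R U)
    \<and> (\<forall>X. ext_bracket br h D U (incl X) = incl (D X))
    \<and> (\<forall>X Y. ext_metric h (incl X) (incl Y) = h X Y)
    \<and> (\<forall>X. ext_metric h (incl X) U = 0)
    \<and> ext_metric h U U = 1
    \<and> (\<not> inner_derivation br D \<and> center br \<subseteq> {X. D X = 0} \<longrightarrow>
         is_direct_sum (derived_algebra (ext_bracket br h D)) (incl ` derived_algebra br) (span {U})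
         \<and> center (ext_bracket br h D) = incl ` center br)"
proof -
  note L = assms(1) and M = assms(2) and der = assms(3) and skew = assms(4)
  have h: "bilinear h" using M by (simp add: ad_invariant_metric_def)
  have D: "linear D" using der by (simp add: derivation_def)
  have b: "bilinear br" using L by (simp add: lie_algebra_def)
  have Lext: "lie_algebra (ext_bracket br h D)"
    by (rule lie_algebra_ext_bracket[OF assms])
  show ?thesis
    using Lext ad_invariant_ext_metric[OF M skew] center_ext_bracket[OF L M]
      derived_algebra_ext_bracket[OF L M Lext skew]
    by (auto simp: ext_bracket_def ext_metric_def incl_def U_def bilinear_lzero[OF b]
        bilinear_rzero[OF h] bilinear_lzero[OF h] linear_0[OF D])
qed

end
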